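(* Let $X$ be a finite dimensional real normed space, let $G$ be a finite simple graph and let $(G,p)$ be a constant framework in $X$. Then the following are equivalent: (i) $(G,p)$ is infinitesimally rigid in $X$; (ii) $(G,p)$ is locally rigid in $X$; (iii) $(G,p)$ is continuously rigid in $X$.
   Context: Normed spaces are real and finite dimensional. $\operatorname{Isom}(X)$ is the group of isometries of $X$. A framework $(G,p)$ in $X$ is a simple graph $G$ with vertex set $V(G)$ and edge set $E(G)$ together with a placement $p=(p_v)_{v\in V(G)}\in X^{V(G)}$. For finite $G$, $X^{V(G)}$ has the norm $\max_v\|x_v\|$. The orbit of $p$ is $\mathcal{O}_p=\{(g(p_v))_{v\in V(G)} : g\in\operatorname{Isom}(X)\}$. Smooth points: $f\in X^*$ is a support functional of $x\in X$ if $\|f\|=\|x\|$ (operator norm on $X^*$) and $f(x)=\|x\|^2$. A non-zero $x$ is smooth if it has exactly one support functional, denoted $\varphi(x)$. $(G,p)$ is well-positioned if $p_v-p_w$ is smooth for every edge $vw\in E(G)$; then $\varphi_{v,w}:=\varphi\left(\frac{p_v-p_w}{\|p_v-p_w\|}\right)$. $\mathcal{W}(G)\subseteq X^{V(G)}$ is the set of well-positioned placements of $G$. Rigidity map: $f_G:X^{V(G)}\to\mathbb{R}^{E(G)}$, $f_G(x)=(\|x_v-x_w\|)_{vw\in E(G)}$. Rigidity operator at $p\in\mathcal{W}(G)$: the linear map $df_G(p):X^{V(G)}\to\mathbb{R}^{E(G)}$, $df_G(p)x=(\varphi_{v,w}(x_v-x_w))_{vw\in E(G)}$. $(G,p)$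 is constant if it is well-positioned and there is a neighbourhood $\mathcal{N}(p)\subset\mathcal{W}(G)$ of $p$ in $X^{V(G)}$ with $\operatorname{rank} df_G(q)=\operatorname{rank} df_G(p)$ for all $q\in\mathcal{N}(p)$. A continuous path through $p$ is a family $\alpha=(\alpha_v)_{v\in V(G)}$ of continuous paths $\alpha_v:(-\delta,\delta)\to X$ (for some fixed $\delta>0$) with $\alpha_v(0)=p_v$ for all $v$. It is a trivial finite motion (trivial finite flex) if $\alpha(t)=(\alpha_v(t))_v\in\mathcal{O}_p$ for all $t\in(-\delta,\delta)$. It is a finite flex of $(G,p)$ if $\|\alpha_v(t)-\alpha_w(t)\|=\|p_v-p_w\|$ for all $vw\in E(G)$ and $t\in(-\delta,\delta)$. A vector $u\in X^{V(G)}$ is a trivial (infinitesimal) flex if there is a trivial finite motion $\alpha$ of $p$ differentiable at $t=0$ with $u_v=\alpha_v'(0)$ for all $v$. For well-positioned $(G,p)$, $u$ is an (infinitesimal) flex if $df_G(p)u=0$. $(G,p)$ is infinitesimally rigid if it is well-positioned and every infinitesimal flex is trivial. $(G,p)$ is continuously rigid if every finite flex of $(G,p)$ is trivial. $(G,p)$ is locally rigid if there is a neighbourhood $U\subseteq X^{V(G)}$ of $p$ such that $f_G^{-1}[f_G(p)]\cap U=\mathcal{O}_p\cap U$. *)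

theory Defs
  imports "HOL-Analysis.Analysis"
begin

text \<open>
  The vertex set of a graph is a finite type \<open>'v\<close>, so that \<open>'a ^ 'v\<close> is the space of placements
  of its vertices in the normed space \<open>'a\<close>. A graph is given by its set of edges.
\<close>

definition simple_graph :: "'v set set \<Rightarrow> bool" where
  "simple_graph E \<longleftrightarrow> (\<forall>e\<in>E. card e = 2)"

text \<open>
  The library norm on \<open>'a ^ 'v\<close> is the Euclidean combination of the norms of the components, not
  their maximum. Only the topology of \<open>'a ^ 'v\<close> is used below, and it is that of the maximum norm.
\<close>

lemma open_vec_iff_max_norm:
  fixes S :: "('a::real_normed_vector ^ 'v::finite) set"
  shows "open S \<longleftrightarrow> (\<forall>x\<in>S. \<exists>e>0. \<forall>y. (MAX v. norm (y $ v - x $ v)) < e \<longrightarrow> y \<in> S)"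
proof -
  have le: "norm (z $ v) \<le> norm z" for z :: "'a ^ 'v" and v
    by (rule Finite_Cartesian_Product.norm_nth_le)
  have ub: "norm z \<le> (\<Sum>v\<in>UNIV. norm (z $ v))" for z :: "'a ^ 'v"
    unfolding norm_vec_def by (rule L2_set_le_sum) simp
  show ?thesis
  proof
    assume S: "open S"
    show "\<forall>x\<in>S. \<exists>e>0. \<forall>y. (MAX v. norm (y $ v - x $ v)) < e \<longrightarrow> y \<in> S"
    proof
      fix x assume "x \<in> S"
      then obtain e where e: "e > 0" "\<And>y. dist y x < e \<Longrightarrow> y \<in> S"
        using S unfolding open_dist by blast
      let ?n = "real CARD('v)"
      have "y \<in> S" if y: "(MAX v. norm (y $ v - x $ v)) < e / ?n" for y
      proof -
        have "norm ((y - x) $ v) < e / ?n" for v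
          using y by (simp add: Max_less_iff)
        then have "(\<Sum>v\<in>UNIV. norm ((y - x) $ v)) < (\<Sum>v\<in>(UNIV::'v set). e / ?n)"
          by (intro sum_strict_mono) auto
        then show ?thesis
          using ub[of "y - x"] by (intro e(2)) (simp add: dist_norm)
      qed
      moreover have "e / ?n > 0" using e(1) by simp
      ultimately show "\<exists>e>0. \<forall>y. (MAX v. norm (y $ v - x $ v)) < e \<longrightarrow> y \<in> S" by blast
    qed
  next
    assume R: "\<forall>x\<in>S. \<exists>e>0. \<forall>y. (MAX v. norm (y $ v - x $ v)) < e \<longrightarrow> y \<in> S"
    show "open S"
      unfolding open_dist
    proof
      fix x assume "x \<in> S"
      then obtain e where e: "e > 0" "\<And>y. (MAX v. norm (y $ v - x $ v)) < e \<Longrightarrow> y \<in> S"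
        using R by blast
      have "y \<in> S" if "dist y x < e" for y
      proof (rule e(2))
        have "norm (y $ v - x $ v) < e" for v
          using le[of "y - x" v] that by (simp add: dist_norm)
        then show "(MAX v. norm (y $ v - x $ v)) < e" by (simp add: Max_less_iff)
      qed
      then show "\<exists>e>0. \<forall>y. dist y x < e \<longrightarrow> y \<in> S" using e(1) by blast
    qed
  qed
qed

definition isometries :: "('a::real_normed_vector \<Rightarrow> 'a) set" where
  "isometries = {g. bij g \<and> (\<forall>x y. norm (g x - g y) = norm (x - y))}"

definition orbit :: "'a::real_normed_vector ^ 'v::finite \<Rightarrow> ('a ^ 'v) set" where
  "orbit p = {(\<chi> v. g (p $ v)) | g. g \<in> isometries}"

definition support_functional :: "('a::real_normed_vector \<Rightarrow>\<^sub>L real) \<Rightarrow> 'a \<Rightarrow> bool" where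
  "support_functional f x \<longleftrightarrow> norm f = norm x \<and> blinfun_apply f x = (norm x)\<^sup>2"

definition smooth_point :: "'a::real_normed_vector \<Rightarrow> bool" where
  "smooth_point x \<longleftrightarrow> x \<noteq> 0 \<and> (\<exists>!f. support_functional f x)"

definition the_support :: "'a::real_normed_vector \<Rightarrow> 'a \<Rightarrow>\<^sub>L real" where
  "the_support x = (THE f. support_functional f x)"

definition edge_support :: "'a::real_normed_vector ^ 'v::finite \<Rightarrow> 'v \<Rightarrow> 'v \<Rightarrow> 'a \<Rightarrow>\<^sub>L real" where
  "edge_support p v w = the_support ((p $ v - p $ w) /\<^sub>R norm (p $ v - p $ w))"

definition well_positioned :: "'v set set \<Rightarrow> 'a::real_normed_vector ^ 'v::finite \<Rightarrow> bool" where
  "well_positioned E p \<longleftrightarrow> (\<forall>v w. {v, w} \<in> E \<longrightarrow> smooth_point (p $ v - p $ w))"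

text \<open>
  The space of real vectors indexed by the edge set is realised as the subspace of
  \<open>real ^ 'v set\<close> of vectors that vanish at every coordinate outside \<open>E\<close>. The entry at an edge is
  the common value of \<open>h v w\<close> over both ways of writing the edge as \<open>{v, w}\<close>; this is meaningful
  only for functions \<open>h\<close> that are symmetric on edges.
\<close>

definition on_edges :: "'v set set \<Rightarrow> ('v \<Rightarrow> 'v \<Rightarrow> real) \<Rightarrow> real ^ ('v::finite set)" where
  "on_edges E h = (\<chi> e. if e \<in> E then (THE r. \<exists>v w. e = {v, w} \<and> r = h v w) else 0)"

lemma on_edges_nth:
  assumes "{v, w} \<in> E" "h v w = h w v"
  shows "on_edges E h $ {v, w} = h v w"
proof -
  have "(THE r. \<exists>v' w'. {v, w} = {v', w'} \<and> r = h v' w') = h v w"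
    using assms(2) by (intro the_equality) (auto simp: doubleton_eq_iff)
  then show ?thesis using assms(1) by (simp add: on_edges_def)
qed

definition rigidity_map ::
    "'v set set \<Rightarrow> 'a::real_normed_vector ^ 'v::finite \<Rightarrow> real ^ ('v set)" where
  "rigidity_map E x = on_edges E (\<lambda>v w. norm (x $ v - x $ w))"

definition rigidity_operator ::
    "'v set set \<Rightarrow> 'a::real_normed_vector ^ 'v::finite \<Rightarrow> 'a ^ 'v \<Rightarrow> real ^ ('v set)" where
  "rigidity_operator E p x =
     on_edges E (\<lambda>v w. blinfun_apply (edge_support p v w) (x $ v - x $ w))"

lemma rigidity_map_nth:
  "{v, w} \<in> E \<Longrightarrow> rigidity_map E x $ {v, w} = norm (x $ v - x $ w)"
  unfolding rigidity_map_def by (subst on_edges_nth) (auto simp: norm_minus_commute)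

lemma support_functional_uminus:
  "support_functional f (- x) \<longleftrightarrow> support_functional (- f) x"
  by (simp add: support_functional_def blinfun.minus_left blinfun.minus_right)

lemma support_functional_scaleR:
  assumes "c > 0"
  shows "support_functional (c *\<^sub>R f) (c *\<^sub>R x) \<longleftrightarrow> support_functional f x"
  using assms by (auto simp: support_functional_def blinfun.scaleR_left blinfun.scaleR_right
      power2_eq_square algebra_simps)

lemma the_support_uminus:
  assumes "smooth_point x"
  shows "the_support (- x) = - the_support x"
proof -
  from assms obtain f where f: "support_functional f x" "\<And>g. support_functional g x \<Longrightarrow> g = f"
    unfolding smooth_point_def by blast
  have "the_support x = f" unfolding the_support_def using f by (intro the_equality)
  moreover have "the_support (- x) = - f"
    unfolding the_support_def support_functional_uminus
  proof (rule the_equality)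
    show "support_functional (- (- f)) x" using f(1) by simp
    show "g = - f" if "support_functional (- g) x" for g
      using f(2)[OF that] by (metis minus_minus)
  qed
  ultimately show ?thesis by simp
qed

lemma smooth_point_scaleR:
  assumes "smooth_point x" "c > 0"
  shows "smooth_point (c *\<^sub>R x)"
proof -
  from assms(1) obtain f where f: "support_functional f x" "\<And>g. support_functional g x \<Longrightarrow> g = f"
    unfolding smooth_point_def by blast
  have "g = c *\<^sub>R f" if g: "support_functional g (c *\<^sub>R x)" for g
  proof -
    have "support_functional (c *\<^sub>R (inverse c *\<^sub>R g)) (c *\<^sub>R x)" using g assms(2) by simp
    then have "inverse c *\<^sub>R g = f" using f(2) support_functional_scaleR[OF assms(2)] by blast
    then show ?thesis using assms(2) by auto
  qed
  moreover have "support_functional (c *\<^sub>R f) (c *\<^sub>R x)"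
    using f(1) support_functional_scaleR[OF assms(2)] by blast
  ultimately show ?thesis using assms unfolding smooth_point_def by auto
qed

lemma edge_support_swap:
  assumes "smooth_point (p $ v - p $ w)"
  shows "edge_support p w v = - edge_support p v w"
proof -
  have "smooth_point ((p $ v - p $ w) /\<^sub>R norm (p $ v - p $ w))"
    using assms by (intro smooth_point_scaleR) (auto simp: smooth_point_def)
  from the_support_uminus[OF this] show ?thesis
    by (simp add: edge_support_def norm_minus_commute[of "p $ w"] flip: scaleR_minus_right)
qed

lemma rigidity_operator_nth:
  assumes "well_positioned E p" "{v, w} \<in> E"
  shows "rigidity_operator E p x $ {v, w} = blinfun_apply (edge_support p v w) (x $ v - x $ w)"
proof -
  have "edge_support p w v = - edge_support p v w"
    using assms by (intro edge_support_swap) (auto simp: well_positioned_def)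
  then have "blinfun_apply (edge_support p v w) (x $ v - x $ w) =
      blinfun_apply (edge_support p w v) (x $ w - x $ v)"
    by (simp add: blinfun.minus_left blinfun.diff_right)
  then show ?thesis
    unfolding rigidity_operator_def using assms(2) by (subst on_edges_nth) auto
qed

lemma linear_rigidity_operator:
  assumes "simple_graph E" "well_positioned E p"
  shows "linear (rigidity_operator E p)"
proof -
  have ex: "\<exists>v w. e = {v, w}" if "e \<in> E" for e
    using assms(1) that unfolding simple_graph_def card_2_iff by blast
  have out: "rigidity_operator E p x $ e = 0" if "e \<notin> E" for x e
    using that by (simp add: rigidity_operator_def on_edges_def)
  show ?thesis
  proof
    fix x y
    have "rigidity_operator E p (x + y) $ e =
        (rigidity_operator E p x + rigidity_operator E p y) $ e" for e
    proof (cases "e \<in> E")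
      case True
      then obtain v w where "e = {v, w}" using ex by blast
      with True show ?thesis
        by (simp add: rigidity_operator_nth[OF assms(2)] blinfun.add_right blinfun.diff_right)
    qed (simp add: out)
    then show "rigidity_operator E p (x + y) = rigidity_operator E p x + rigidity_operator E p y"
      by (simp add: vec_eq_iff)
  next
    fix c x
    have "rigidity_operator E p (c *\<^sub>R x) $ e = (c *\<^sub>R rigidity_operator E p x) $ e" for e
    proof (cases "e \<in> E")
      case True
      then obtain v w where "e = {v, w}" using ex by blast
      with True show ?thesis
        by (simp add: rigidity_operator_nth[OF assms(2)] blinfun.scaleR_right blinfun.diff_right
            right_diff_distrib)
    qed (simp add: out)
    then show "rigidity_operator E p (c *\<^sub>R x) = c *\<^sub>R rigidity_operator E p x"
      by (simp add: vec_eq_iff)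
  qed
qed

definition rigidity_rank :: "'v set set \<Rightarrow> 'a::real_normed_vector ^ 'v::finite \<Rightarrow> nat" where
  "rigidity_rank E p = dim (range (rigidity_operator E p))"

definition constant_framework :: "'v set set \<Rightarrow> 'a::real_normed_vector ^ 'v::finite \<Rightarrow> bool" where
  "constant_framework E p \<longleftrightarrow> well_positioned E p \<and>
     (\<exists>N. open N \<and> p \<in> N \<and> N \<subseteq> {q. well_positioned E q} \<and>
       (\<forall>q\<in>N. rigidity_rank E q = rigidity_rank E p))"

text \<open>
  A path on \<open>(-\<delta>, \<delta>)\<close> is a function on all of the reals whose values outside of that interval are
  irrelevant.
\<close>

definition continuous_path ::
    "'a::real_normed_vector ^ 'v::finite \<Rightarrow> real \<Rightarrow> ('v \<Rightarrow> real \<Rightarrow> 'a) \<Rightarrow> bool" where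
  "continuous_path p \<delta> \<alpha> \<longleftrightarrow>
     \<delta> > 0 \<and> (\<forall>v. continuous_on {-\<delta><..<\<delta>} (\<alpha> v) \<and> \<alpha> v 0 = p $ v)"

definition trivial_finite_motion ::
    "'a::real_normed_vector ^ 'v::finite \<Rightarrow> real \<Rightarrow> ('v \<Rightarrow> real \<Rightarrow> 'a) \<Rightarrow> bool" where
  "trivial_finite_motion p \<delta> \<alpha> \<longleftrightarrow>
     continuous_path p \<delta> \<alpha> \<and> (\<forall>t\<in>{-\<delta><..<\<delta>}. (\<chi> v. \<alpha> v t) \<in> orbit p)"

definition finite_flex ::
    "'v set set \<Rightarrow> 'a::real_normed_vector ^ 'v::finite \<Rightarrow> real \<Rightarrow> ('v \<Rightarrow> real \<Rightarrow> 'a) \<Rightarrow> bool" where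
  "finite_flex E p \<delta> \<alpha> \<longleftrightarrow> continuous_path p \<delta> \<alpha> \<and>
     (\<forall>v w. {v, w} \<in> E \<longrightarrow>
       (\<forall>t\<in>{-\<delta><..<\<delta>}. norm (\<alpha> v t - \<alpha> w t) = norm (p $ v - p $ w)))"

definition trivial_flex :: "'a::real_normed_vector ^ 'v::finite \<Rightarrow> 'a ^ 'v \<Rightarrow> bool" where
  "trivial_flex p u \<longleftrightarrow> (\<exists>\<delta> \<alpha>. trivial_finite_motion p \<delta> \<alpha> \<and>
     (\<forall>v. (\<alpha> v has_vector_derivative u $ v) (at 0)))"

definition infinitesimal_flex ::
    "'v set set \<Rightarrow> 'a::real_normed_vector ^ 'v::finite \<Rightarrow> 'a ^ 'v \<Rightarrow> bool" where
  "infinitesimal_flex E p u \<longleftrightarrow> rigidity_operator E p u = 0"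

definition infinitesimally_rigid :: "'v set set \<Rightarrow> 'a::real_normed_vector ^ 'v::finite \<Rightarrow> bool" where
  "infinitesimally_rigid E p \<longleftrightarrow>
     well_positioned E p \<and> (\<forall>u. infinitesimal_flex E p u \<longrightarrow> trivial_flex p u)"

definition continuously_rigid :: "'v set set \<Rightarrow> 'a::real_normed_vector ^ 'v::finite \<Rightarrow> bool" where
  "continuously_rigid E p \<longleftrightarrow> (\<forall>\<delta> \<alpha>. finite_flex E p \<delta> \<alpha> \<longrightarrow> trivial_finite_motion p \<delta> \<alpha>)"

definition locally_rigid :: "'v set set \<Rightarrow> 'a::real_normed_vector ^ 'v::finite \<Rightarrow> bool" where
  "locally_rigid E p \<longleftrightarrow>
     (\<exists>U. open U \<and> p \<in> U \<and> rigidity_map E -` {rigidity_map E p} \<inter> U = orbit p \<inter> U)"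

end

theory Submission
  imports Defs
begin

text \<open>
  The three notions are linked in a circle: infinitesimal rigidity implies local rigidity, which
  implies continuous rigidity, which implies infinitesimal rigidity. The isometry group enters
  through compactness and distances: closed bounded sets of isometries are compact, so orbits are
  closed and have nearest points.

  Analysis enters through the derivative of the norm. On an open set of smooth points, the
  normalised support functional depends continuously on the point, as the unit sphere of the dual
  space is compact, and it is the derivative of the norm. Hence the rigidity map is continuously
  differentiable near \<open>p\<close>, with the rigidity operator as its derivative
  (\<open>has_derivative_rigidity_map\<close>, \<open>continuous_on_rigidity_operator\<close>).

  From infinitesimal to local rigidity: if points of the fibre of the rigidity map approach \<open>p\<close>
  from outside of the orbit, then isometries can be applied to make \<open>p\<close> their nearest point in the
  orbit. Their limiting direction \<open>u\<close>, seen from \<open>p\<close>, lies in the kernel of the rigidity operator,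
  so \<open>u\<close> is the velocity of a motion within the orbit. But then the orbit comes closer to these
  points than \<open>p\<close>, a contradiction.

  From local to continuous rigidity: local rigidity at \<open>p\<close> holds at every point of the orbit, so
  the set of times that a finite flex spends in the orbit is open; it is closed because the orbit is.

  From continuous to infinitesimal rigidity: as the rank is constant, each vector \<open>u\<close> in the kernel
  of the rigidity operator is the velocity of a curve in the fibre (\<open>constant_rank_curve\<close>). That
  curve is a finite flex, hence trivial, and so \<open>u\<close> is a trivial flex.
\<close>

section \<open>Finite-dimensional normed spaces\<close>

text \<open>
  Tychonoff's theorem, for the topology of pointwise convergence on a function type.
\<close>

lemma compact_pointwise:
  fixes S :: "'i \<Rightarrow> 'b::topological_space set"
  assumes "\<And>i. compact (S i)"
  shows "compact {f. \<forall>i. f i \<in> S i}"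
proof -
  have "compactin (product_topology (\<lambda>i. euclidean) UNIV) (Pi\<^sub>E UNIV S)"
    using assms by (subst compactin_PiE) auto
  then have "compact (Pi\<^sub>E UNIV S)"
    by (simp add: euclidean_product_topology)
  then show ?thesis
    by (simp add: PiE_UNIV_domain Pi_def)
qed

text \<open>
  All norms on a finite-dimensional space are equivalent. The function
  \<open>a \<mapsto> norm (\<Sum>b\<in>B. a b *\<^sub>R b)\<close> is continuous and has no zero on the unit sphere of the sum
  norm. Coefficient families live in the function space, and that sphere is compact there once
  the coefficients off \<open>B\<close> are fixed to be zero.
\<close>

lemma independent_norm_bound:
  fixes B :: "'a::real_normed_vector set"
  assumes "finite B" "independent B"
  obtains c where "c > 0" "\<And>a. c * (\<Sum>b\<in>B. \<bar>a b\<bar>) \<le> norm (\<Sum>b\<in>B. a b *\<^sub>R b)"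
proof -
  define K where "K = {a::'a \<Rightarrow> real. \<forall>b. a b \<in> (if b \<in> B then {-1..1} else {0})} \<inter>
                      {a. (\<Sum>b\<in>B. \<bar>a b\<bar>) = 1}"
  define n where "n = (\<lambda>a::'a \<Rightarrow> real. norm (\<Sum>b\<in>B. a b *\<^sub>R b))"
  have "closed {a::'a \<Rightarrow> real. (\<Sum>b\<in>B. \<bar>a b\<bar>) = 1}"
    by (intro closed_Collect_eq continuous_intros continuous_on_product_coordinates)
  then have "compact K"
    unfolding K_def by (intro compact_Int_closed compact_pointwise) auto
  have contn: "continuous_on K n"
    unfolding n_def
    by (intro continuous_intros continuous_on_subset[OF continuous_on_product_coordinates]) auto
  have scale: "(\<lambda>b. if b \<in> B then a b / (\<Sum>b\<in>B. \<bar>a b\<bar>) else 0) \<in> K" if "(\<Sum>b\<in>B. \<bar>a b\<bar>) \<noteq> 0" for a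
  proof -
    have pos: "(\<Sum>b\<in>B. \<bar>a b\<bar>) > 0"
      using that by (simp add: sum_nonneg order_le_neq_trans[OF _ not_sym])
    have "\<bar>a b\<bar> \<le> (\<Sum>b\<in>B. \<bar>a b\<bar>)" if "b \<in> B" for b
      using that assms(1) by (intro member_le_sum) auto
    then have "a b \<le> (\<Sum>b\<in>B. \<bar>a b\<bar>)" "- (\<Sum>b\<in>B. \<bar>a b\<bar>) \<le> a b" if "b \<in> B" for b
      using that by (force simp: abs_le_iff)+
    with pos show ?thesis
      unfolding K_def by (auto simp: field_simps simp flip: sum_divide_distrib)
  qed
  have hom: "n (\<lambda>b. if b \<in> B then a b / s else 0) = n a / s" if "s > 0" for a s
  proof -
    have "(\<Sum>b\<in>B. (if b \<in> B then a b / s else 0) *\<^sub>R b) = (1 / s) *\<^sub>R (\<Sum>b\<in>B. a b *\<^sub>R b)"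
      by (simp add: scaleR_sum_right)
    then show ?thesis unfolding n_def using that by simp
  qed
  have pos: "n a > 0" if "a \<in> K" for a
  proof -
    have "n a \<noteq> 0"
    proof
      assume "n a = 0"
      then have "a b = 0" if "b \<in> B" for b
        using assms that unfolding n_def by (auto simp: dependent_finite)
      then have "(\<Sum>b\<in>B. \<bar>a b\<bar>) = 0" by simp
      then show False using \<open>a \<in> K\<close> by (simp add: K_def)
    qed
    then show ?thesis by (simp add: n_def)
  qed
  obtain c where c: "c > 0" "\<And>a. a \<in> K \<Longrightarrow> c \<le> n a"
  proof (cases "K = {}")
    case True
    then show ?thesis using that[of 1] by auto
  next
    case False
    from continuous_attains_inf[OF \<open>compact K\<close> False contn] show ?thesis
      using that pos by blast
  qed
  have "c * (\<Sum>b\<in>B. \<bar>a b\<bar>) \<le> n a" for a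
  proof (cases "(\<Sum>b\<in>B. \<bar>a b\<bar>) = 0")
    case True
    then show ?thesis by (simp add: n_def)
  next
    case False
    then have "(\<Sum>b\<in>B. \<bar>a b\<bar>) > 0"
      by (simp add: sum_nonneg order_le_neq_trans[OF _ not_sym])
    then show ?thesis
      using c(2)[OF scale[OF False]] hom[of "\<Sum>b\<in>B. \<bar>a b\<bar>" a] by (simp add: field_simps)
  qed
  with c(1) show ?thesis using that unfolding n_def by blast
qed

text \<open>
  A predicate on the type rather than on a set, so that the property can be passed on from a space
  to its dual and to its space of placements.
\<close>

definition finite_dim :: "'a::real_normed_vector itself \<Rightarrow> bool" where
  "finite_dim _ \<longleftrightarrow> (\<exists>B::'a set. finite B \<and> span B = UNIV)"

lemma finite_dim_basis:
  assumes "finite_dim TYPE('a::real_normed_vector)"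
  obtains B :: "'a::real_normed_vector set" where "finite B" "independent B" "span B = UNIV"
proof -
  obtain S :: "'a set" where S: "finite S" "span S = UNIV"
    using assms unfolding finite_dim_def by blast
  obtain B where "B \<subseteq> S" "independent B" "S \<subseteq> span B"
    using maximal_independent_subset[of S] by blast
  then show ?thesis
    using that[of B] S by (metis finite_subset span_minimal subspace_span top.extremum_uniqueI)
qed

text \<open>
  The Heine-Borel theorem: by equivalence of norms, a bounded set lies in the image of a compact
  cube of coefficients.
\<close>

lemma finite_dim_compact:
  fixes S :: "'a::real_normed_vector set"
  assumes "finite_dim TYPE('a)" "closed S" "bounded S"
  shows "compact S"
proof -
  obtain B :: "'a set" where B: "finite B" "independent B" "span B = UNIV"
    using finite_dim_basis[OF assms(1)] .
  obtain c where c: "c > 0" "\<And>a. c * (\<Sum>b\<in>B. \<bar>a b\<bar>) \<le> norm (\<Sum>b\<in>B. a b *\<^sub>R b)"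
    using independent_norm_bound[OF B(1,2)] by blast
  obtain R where R: "\<And>x. x \<in> S \<Longrightarrow> norm x \<le> R"
    using assms(3) unfolding bounded_iff by blast
  define K where "K = {a::'a \<Rightarrow> real. \<forall>b. a b \<in> {-(R/c)..R/c}}"
  have "compact ((\<lambda>a. \<Sum>b\<in>B. a b *\<^sub>R b) ` K)"
    unfolding K_def
    by (intro compact_continuous_image compact_pointwise continuous_intros
        continuous_on_subset[OF continuous_on_product_coordinates]) auto
  then have "compact ((\<lambda>a. \<Sum>b\<in>B. a b *\<^sub>R b) ` K \<inter> S)"
    by (rule compact_Int_closed[OF _ assms(2)])
  moreover have "S \<subseteq> (\<lambda>a. \<Sum>b\<in>B. a b *\<^sub>R b) ` K"
  proof
    fix x assume "x \<in> S"
    obtain a where a: "x = (\<Sum>b\<in>B. a b *\<^sub>R b)"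
      using B span_finite[OF B(1)] by (metis (no_types, lifting) UNIV_I imageE)
    have "a b \<in> {-(R/c)..R/c}" if "b \<in> B" for b
    proof -
      have "c * \<bar>a b\<bar> \<le> c * (\<Sum>b\<in>B. \<bar>a b\<bar>)"
        using that B(1) c(1) by (intro mult_left_mono member_le_sum) auto
      also have "\<dots> \<le> R" using c(2)[of a] R[OF \<open>x \<in> S\<close>] a by simp
      finally have "\<bar>a b\<bar> \<le> R / c" using c(1) by (simp add: field_simps)
      then show ?thesis by (auto simp: abs_le_iff)
    qed
    moreover have "0 \<le> R / c"
      using R[OF \<open>x \<in> S\<close>] c(1) norm_ge_zero[of x] by (intro divide_nonneg_pos) linarith+
    ultimately have "(\<lambda>b. if b \<in> B then a b else 0) \<in> K"
      by (auto simp: K_def)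
    then show "x \<in> (\<lambda>a. \<Sum>b\<in>B. a b *\<^sub>R b) ` K"
      by (rule rev_image_eqI) (simp add: a)
  qed
  ultimately show ?thesis
    by (simp only: Int_absorb1)
qed

text \<open>
  The coordinate functionals of a basis are bounded, again by equivalence of norms, and they span
  the dual space. This is what makes the unit sphere of the dual compact.
\<close>

lemma finite_dim_dual:
  assumes "finite_dim TYPE('a::real_normed_vector)"
  shows "finite_dim TYPE('a \<Rightarrow>\<^sub>L real)"
proof -
  obtain B :: "'a set" where B: "finite B" "independent B" "span B = UNIV"
    using finite_dim_basis[OF assms(1)] .
  obtain c where c: "c > 0" "\<And>a. c * (\<Sum>b\<in>B. \<bar>a b\<bar>) \<le> norm (\<Sum>b\<in>B. a b *\<^sub>R b)"
    using independent_norm_bound[OF B(1,2)] by blast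
  have expand: "(\<Sum>b\<in>B. representation B x b *\<^sub>R b) = x" for x
    using B by (intro sum_representation_eq) auto
  have bl: "bounded_linear (\<lambda>x. representation B x b)" if "b \<in> B" for b
  proof (rule bounded_linear_intro[where K = "1/c"])
    fix x y r
    show "representation B (x + y) b = representation B x b + representation B y b"
      using B by (simp add: representation_add)
    show "representation B (r *\<^sub>R x) b = r *\<^sub>R representation B x b"
      using B by (simp add: representation_scale)
    have "c * \<bar>representation B x b\<bar> \<le> c * (\<Sum>b\<in>B. \<bar>representation B x b\<bar>)"
      using that B(1) c(1) by (intro mult_left_mono member_le_sum) auto
    also have "\<dots> \<le> norm x"
      using c(2)[of "representation B x"] expand by simp
    finally show "norm (representation B x b) \<le> norm x * (1/c)"
      using c(1) by (simp add: field_simps)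
  qed
  define \<beta> where "\<beta> b = Blinfun (\<lambda>x. representation B x b)" for b
  have "f \<in> span (\<beta> ` B)" for f :: "'a \<Rightarrow>\<^sub>L real"
  proof -
    have "blinfun_apply f x = blinfun_apply (\<Sum>b\<in>B. blinfun_apply f b *\<^sub>R \<beta> b) x" for x
    proof -
      have "blinfun_apply f x = (\<Sum>b\<in>B. representation B x b * blinfun_apply f b)"
        by (subst expand[of x, symmetric]) (simp add: blinfun.sum_right blinfun.scaleR_right)
      also have "\<dots> = blinfun_apply (\<Sum>b\<in>B. blinfun_apply f b *\<^sub>R \<beta> b) x"
        by (simp add: blinfun.sum_left blinfun.scaleR_left \<beta>_def bounded_linear_Blinfun_apply[OF bl]
            mult.commute)
      finally show ?thesis .
    qed
    then have "f = (\<Sum>b\<in>B. blinfun_apply f b *\<^sub>R \<beta> b)"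
      by (rule blinfun_eqI)
    also have "\<dots> \<in> span (\<beta> ` B)"
      by (intro span_sum span_scale span_base) auto
    finally show ?thesis .
  qed
  then show ?thesis
    unfolding finite_dim_def using B(1) by (intro exI[of _ "\<beta> ` B"]) auto
qed

lemma finite_dim_vec:
  assumes "finite_dim TYPE('a::real_normed_vector)"
  shows "finite_dim TYPE('a ^ 'v::finite)"
proof -
  obtain B :: "'a set" where B: "finite B" "span B = UNIV"
    using assms unfolding finite_dim_def by blast
  define C where "C = (\<Union>v::'v. axis v ` B)"
  have lin: "linear (axis v :: 'a \<Rightarrow> 'a ^ 'v)" for v
    by (intro linearI) (auto simp: axis_def vec_eq_iff)
  have "x \<in> span C" for x :: "'a ^ 'v"
  proof -
    have "axis v (x $ v) \<in> span C" for v
    proof -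
      have "axis v (x $ v) \<in> axis v ` span B" using B(2) by simp
      also have "\<dots> = span (axis v ` B)" by (rule linear_span_image[OF lin, symmetric])
      also have "\<dots> \<subseteq> span C" by (intro span_mono) (auto simp: C_def)
      finally show ?thesis .
    qed
    then have "(\<Sum>v\<in>UNIV. axis v (x $ v)) \<in> span C" by (intro span_sum)
    moreover have "(\<Sum>v\<in>UNIV. axis v (x $ v)) = x"
      by (simp add: vec_eq_iff axis_def if_distrib[of "\<lambda>y. y = _"] if_distribR cong: if_cong)
    ultimately show ?thesis by simp
  qed
  then show ?thesis
    unfolding finite_dim_def using B(1) by (intro exI[of _ C]) (auto simp: C_def)
qed

section \<open>The support functional as the derivative of the norm\<close>

text \<open>
  The normalised support functional. At a smooth point it is the unique functional of norm one
  that attains the norm there, and it turns out to be the derivative of the norm.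
\<close>

definition norm_gradient :: "'a::real_normed_vector \<Rightarrow> 'a \<Rightarrow>\<^sub>L real" where
  "norm_gradient x = the_support (x /\<^sub>R norm x)"

lemma support_functional_unit:
  assumes "x \<noteq> 0"
  shows "support_functional f (x /\<^sub>R norm x) \<longleftrightarrow> norm f = 1 \<and> blinfun_apply f x = norm x"
  using assms by (auto simp: support_functional_def blinfun.scaleR_right field_simps)

lemma norm_gradient:
  assumes "smooth_point x"
  shows "norm (norm_gradient x) = 1" "blinfun_apply (norm_gradient x) x = norm x"
    and norm_gradient_unique: "\<And>f. norm f = 1 \<Longrightarrow> blinfun_apply f x = norm x \<Longrightarrow> f = norm_gradient x"
proof -
  have x: "x \<noteq> 0" using assms by (simp add: smooth_point_def)
  then have "smooth_point (x /\<^sub>R norm x)"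
    using assms by (intro smooth_point_scaleR) auto
  then have ex: "\<exists>!f. support_functional f (x /\<^sub>R norm x)"
    by (simp add: smooth_point_def)
  have "support_functional (norm_gradient x) (x /\<^sub>R norm x)"
    unfolding norm_gradient_def the_support_def using ex by (rule theI')
  then show "norm (norm_gradient x) = 1" "blinfun_apply (norm_gradient x) x = norm x"
    by (simp_all add: support_functional_unit[OF x])
  show "f = norm_gradient x" if "norm f = 1" "blinfun_apply f x = norm x" for f
    unfolding norm_gradient_def the_support_def
    using that ex by (intro the1_equality[symmetric]) (simp_all add: support_functional_unit[OF x])
qed

text \<open>
  Let smooth points \<open>X n\<close> tend to a smooth point \<open>x\<close>. If the gradients at the \<open>X n\<close> stayed away from
  the gradient at \<open>x\<close> along a subsequence, then by compactness of the dual sphere they would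
  accumulate at another functional. But an accumulation point has norm one and attains the norm at
  \<open>x\<close>, so it is the gradient at \<open>x\<close> by uniqueness.
\<close>

lemma continuous_on_norm_gradient:
  assumes "finite_dim TYPE('a::real_normed_vector)"
  shows "continuous_on {x::'a. smooth_point x} norm_gradient"
  unfolding continuous_on_sequentially
proof (intro allI ballI impI, elim conjE)
  fix X :: "nat \<Rightarrow> 'a" and x
  assume x: "x \<in> {x. smooth_point x}" and X: "\<forall>n. X n \<in> {x. smooth_point x}" "X \<longlonglongrightarrow> x"
  have comp: "compact {f::'a \<Rightarrow>\<^sub>L real. norm f = 1}"
    by (intro finite_dim_compact finite_dim_dual assms closed_Collect_eq continuous_intros)
      (auto simp: bounded_iff)
  show "(norm_gradient \<circ> X) \<longlonglongrightarrow> norm_gradient x"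
  proof (rule ccontr)
    assume "\<not> ?thesis"
    then obtain e where e: "e > 0" "\<exists>\<^sub>F n in sequentially. dist (norm_gradient (X n)) (norm_gradient x) \<ge> e"
      unfolding tendsto_iff o_def by (auto simp: not_eventually not_less)
    then have inf: "infinite {n. dist (norm_gradient (X n)) (norm_gradient x) \<ge> e}"
      by (simp add: frequently_cofinite flip: cofinite_eq_sequentially)
    obtain r :: "nat \<Rightarrow> nat" where r: "strict_mono r"
        "\<And>n. dist (norm_gradient (X (r n))) (norm_gradient x) \<ge> e"
      using infinite_enumerate[OF inf] by (auto simp only: mem_Collect_eq)
    have "\<forall>n. norm_gradient (X (r n)) \<in> {f. norm f = 1}"
      using X(1) norm_gradient(1) by auto
    then obtain f s where s: "f \<in> {f. norm f = 1}" "strict_mono s" "(\<lambda>n. norm_gradient (X (r (s n)))) \<longlonglongrightarrow> f"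
      using comp[unfolded compact_def, rule_format, of "\<lambda>n. norm_gradient (X (r n))"]
      by (auto simp: o_def)
    have lim: "(\<lambda>n. X (r (s n))) \<longlonglongrightarrow> x"
      using LIMSEQ_subseq_LIMSEQ[OF X(2) strict_mono_o[OF r(1) s(2)]] by (simp add: o_def)
    have "(\<lambda>n. blinfun_apply (norm_gradient (X (r (s n)))) (X (r (s n)))) \<longlonglongrightarrow> blinfun_apply f x"
      by (intro tendsto_intros s(3) lim)
    moreover have "blinfun_apply (norm_gradient (X (r (s n)))) (X (r (s n))) = norm (X (r (s n)))" for n
      using X(1) by (intro norm_gradient(2)) simp
    ultimately have "(\<lambda>n. norm (X (r (s n)))) \<longlonglongrightarrow> blinfun_apply f x"
      by simp
    then have "blinfun_apply f x = norm x"
      by (rule LIMSEQ_unique) (intro tendsto_intros lim)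
    then have "f = norm_gradient x"
      using x s(1) by (intro norm_gradient_unique) auto
    then have "(\<lambda>n. dist (norm_gradient (X (r (s n)))) (norm_gradient x)) \<longlonglongrightarrow> 0"
      using tendsto_dist_iff[THEN iffD1, OF s(3)] by simp
    then have "e \<le> 0"
      using r(2) by (meson LIMSEQ_le_const)
    then show False using e(1) by simp
  qed
qed

text \<open>
  For smooth \<open>x\<close> and \<open>y\<close> the increment \<open>norm y - norm x\<close> lies between the values at \<open>y - x\<close> of the
  gradients at \<open>x\<close> and at \<open>y\<close>, because either functional is dominated by the norm. Continuity of
  the gradient then gives the derivative. The argument uses support functionals at nearby points,
  whence the interior.
\<close>

lemma has_derivative_norm_smooth:
  fixes x :: "'a::real_normed_vector"
  assumes "finite_dim TYPE('a)" and x: "x \<in> interior {x. smooth_point x}"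
  shows "(norm has_derivative blinfun_apply (norm_gradient x)) (at x)"
proof -
  let ?S = "interior {x::'a. smooth_point x}"
  have sm: "smooth_point y" if "y \<in> ?S" for y
    using that interior_subset by blast
  have le: "blinfun_apply (norm_gradient x) y \<le> norm y" if "x \<in> ?S" for x y
    using norm_blinfun[of "norm_gradient x" y] norm_gradient(1)[OF sm[OF that]] by simp
  have "\<bar>norm y - norm x - blinfun_apply (norm_gradient x) (y - x)\<bar> \<le>
        norm (norm_gradient y - norm_gradient x) * norm (y - x)" if "y \<in> ?S" for y
  proof -
    have "blinfun_apply (norm_gradient x) (y - x) \<le> norm y - norm x"
      using le[OF x, of y] norm_gradient(2)[OF sm[OF x]] by (simp add: blinfun.diff_right)
    moreover have "norm y - norm x \<le> blinfun_apply (norm_gradient y) (y - x)"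
      using le[OF that, of x] norm_gradient(2)[OF sm[OF that]] by (simp add: blinfun.diff_right)
    moreover have "blinfun_apply (norm_gradient y) (y - x) - blinfun_apply (norm_gradient x) (y - x) \<le>
        norm (norm_gradient y - norm_gradient x) * norm (y - x)"
      using norm_blinfun[of "norm_gradient y - norm_gradient x" "y - x"]
      by (simp add: blinfun.diff_left)
    ultimately show ?thesis by linarith
  qed
  then have "\<forall>\<^sub>F y in at x. norm ((norm y - norm x - blinfun_apply (norm_gradient x) (y - x)) / norm (y - x))
     \<le> norm (norm_gradient y - norm_gradient x)"
    by (intro eventually_mono[OF eventually_at_in_open'[OF open_interior x]])
      (simp add: divide_le_eq)
  moreover have "((\<lambda>y. norm (norm_gradient y - norm_gradient x)) \<longlongrightarrow> 0) (at x)"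
  proof -
    have "continuous_on ?S norm_gradient"
      using continuous_on_norm_gradient[OF assms(1)] interior_subset by (rule continuous_on_subset)
    then have "(norm_gradient \<longlongrightarrow> norm_gradient x) (at x)"
      using x by (simp add: continuous_on_eq_continuous_at isCont_def)
    then show ?thesis
      using LIM_zero tendsto_norm_zero by blast
  qed
  ultimately have "((\<lambda>y. (norm y - norm x - blinfun_apply (norm_gradient x) (y - x)) / norm (y - x)) \<longlongrightarrow> 0) (at x)"
    by (rule Lim_null_comparison)
  then show ?thesis
    by (simp add: has_derivative_at_within blinfun.bounded_linear_right divide_inverse_commute)
qed

section \<open>The derivative of the rigidity map\<close>

text \<open>
  Moving only the vertex \<open>v\<close> realises every vector near \<open>q $ v - q $ w\<close> as the difference along the
  edge in a placement that is still well-positioned.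
\<close>

lemma edge_difference_interior_smooth:
  fixes q :: "'a::real_normed_vector ^ 'v::finite"
  assumes "simple_graph E" "open N" "N \<subseteq> {q. well_positioned E q}" "q \<in> N" "{v, w} \<in> E"
  shows "q $ v - q $ w \<in> interior {x. smooth_point x}"
proof (rule interiorI)
  have "v \<noteq> w"
    using assms(1,5) unfolding simple_graph_def by fastforce
  define place where "place = (\<lambda>x. \<chi> i. if i = v then x + q $ w else q $ i)"
  have "continuous_on UNIV (\<lambda>x. if i = v then x + q $ w else q $ i)" for i
    by (cases "i = v") (auto intro: continuous_intros)
  then have "continuous_on UNIV place"
    unfolding place_def by (intro continuous_on_vec_lambda)
  then show "open (place -` N)"
    using assms(2) by (intro open_vimage)
  have "place (q $ v - q $ w) = q"
    by (simp add: place_def vec_eq_iff)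
  then show "q $ v - q $ w \<in> place -` N"
    using assms(4) by simp
  have "smooth_point x" if "place x \<in> N" for x
  proof -
    have "smooth_point (place x $ v - place x $ w)"
      using that assms(3,5) unfolding well_positioned_def by blast
    then show ?thesis using \<open>v \<noteq> w\<close> by (simp add: place_def)
  qed
  then show "place -` N \<subseteq> {x. smooth_point x}" by auto
qed

lemma edge_cases [consumes 1, case_names non_edge edge]:
  assumes "simple_graph E" and "e \<notin> E \<Longrightarrow> Q e" and "\<And>v w. {v, w} \<in> E \<Longrightarrow> Q {v, w}"
  shows "Q e"
  using assms unfolding simple_graph_def by (metis card_2_iff)

lemma on_edges_outside: "e \<notin> E \<Longrightarrow> on_edges E h $ e = 0"
  by (simp add: on_edges_def)

lemma edge_support_eq_norm_gradient: "edge_support q v w = norm_gradient (q $ v - q $ w)"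
  by (simp add: edge_support_def norm_gradient_def)

lemma has_derivative_rigidity_map:
  fixes q :: "'a::real_normed_vector ^ 'v::finite"
  assumes fd: "finite_dim TYPE('a)" and E: "simple_graph E"
    and N: "open N" "N \<subseteq> {q. well_positioned E q}" "q \<in> N"
  shows "(rigidity_map E has_derivative rigidity_operator E q) (at q)"
proof -
  have wp: "well_positioned E q"
    using N by blast
  have "((\<lambda>x. rigidity_map E x $ e) has_derivative (\<lambda>x. rigidity_operator E q x $ e)) (at q)" for e
    using E
  proof (induction e rule: edge_cases)
    case non_edge
    then show ?case
      by (simp add: rigidity_map_def rigidity_operator_def on_edges_outside)
  next
    case (edge v w)
    have "((\<lambda>x. x $ v - x $ w) has_derivative (\<lambda>x. x $ v - x $ w)) (at q)"
      by (intro bounded_linear_imp_has_derivative bounded_linear_sub bounded_linear_vec_nth)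
    from has_derivative_compose[OF this has_derivative_norm_smooth[OF fd
          edge_difference_interior_smooth[OF E N edge]]]
    show ?case
      using edge by (simp add: rigidity_map_nth rigidity_operator_nth[OF wp] edge_support_eq_norm_gradient)
  qed
  then show ?thesis
    by (subst has_derivative_componentwise_within) (auto simp: Basis_vec_def inner_axis)
qed

lemma continuous_on_rigidity_operator:
  fixes x :: "'a::real_normed_vector ^ 'v::finite"
  assumes fd: "finite_dim TYPE('a)" and E: "simple_graph E"
    and N: "N \<subseteq> {q. well_positioned E q}"
  shows "continuous_on N (\<lambda>q. rigidity_operator E q x)"
proof -
  have "continuous_on N (\<lambda>q. rigidity_operator E q x $ e)" for e
    using E
  proof (induction e rule: edge_cases)
    case non_edge
    then show ?case
      by (simp add: rigidity_operator_def on_edges_outside)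
  next
    case (edge v w)
    have "continuous_on N (\<lambda>q. norm_gradient (q $ v - q $ w))"
      by (rule continuous_on_compose2[OF continuous_on_norm_gradient[OF fd]])
        (use N edge in \<open>auto simp: well_positioned_def intro!: continuous_intros\<close>)
    then have "continuous_on N (\<lambda>q. blinfun_apply (norm_gradient (q $ v - q $ w)) (x $ v - x $ w))"
      by (intro continuous_intros)
    then show ?case
      by (rule continuous_on_eq)
        (use N edge in \<open>auto simp: rigidity_operator_nth edge_support_eq_norm_gradient\<close>)
  qed
  then have "continuous_on N (\<lambda>q. \<chi> e. rigidity_operator E q x $ e)"
    by (rule continuous_on_vec_lambda)
  then show ?thesis by simp
qed

section \<open>Curves in the fibres of a map of constant rank\<close>

text \<open>
  If a linear map does not lower the dimension of a subspace, then the image of a basis is again a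
  basis of the image, so the map is injective on the subspace.
\<close>

lemma linear_kernel_trivial_on_subspace:
  fixes P :: "'e::euclidean_space \<Rightarrow> 'e"
  assumes "subspace T" "linear P" "dim T \<le> dim (P ` T)" "x \<in> T" "P x = 0"
  shows "x = 0"
proof -
  obtain B where B: "B \<subseteq> T" "independent B" "T \<subseteq> span B" "card B = dim T"
    using basis_exists by blast
  have "finite B"
    using B(2) independent_imp_finite by blast
  have T: "T = span B"
    using B(1,3) assms(1) span_minimal by blast
  have PT: "P ` T = span (P ` B)"
    unfolding T by (rule linear_span_image[OF assms(2), symmetric])
  have "card B \<le> card (P ` B)"
    using assms(3) B(4) dim_le_card[of "P ` T" "P ` B"] \<open>finite B\<close> by (simp add: PT)
  then have "card (P ` B) = card B"
    using card_image_le[OF \<open>finite B\<close>, of P] by simp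
  then have inj: "inj_on P B"
    using eq_card_imp_inj_on[OF \<open>finite B\<close>] by blast
  have "independent (P ` B)"
    using assms(3) B(4) \<open>card (P ` B) = card B\<close> \<open>finite B\<close>
    by (intro card_le_dim_spanning[of "P ` B" "P ` T"]) (auto simp: PT span_superset)
  then have "inj_on P T"
    unfolding T using linear_inj_on_span_iff_independent_image[OF assms(2)] inj by blast
  then show ?thesis
    using assms(1,2,4,5) by (metis inj_onD linear_0 subspace_0)
qed

text \<open>
  The part of the constant rank theorem that is needed here: every vector in the kernel of the
  derivative at \<open>p\<close> is the velocity at \<open>p\<close> of a curve within the fibre of \<open>F\<close>.

  The domain of \<open>F\<close> is an abstract normed space. To work in a Euclidean space instead, the curve is
  sought in the form \<open>p + s *\<^sub>R u + M z\<close> with \<open>z\<close> in the codomain,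
  where \<open>M\<close> is a right inverse of \<open>D p\<close> on its range. With the projection \<open>P = D p \<circ> M\<close> onto this
  range, the map \<open>H (s, z) = (s, P (F (p + s *\<^sub>R u + M z)) + (z - P z))\<close> is an endomap of a
  Euclidean space whose derivative at the origin is the identity. Its local inverse \<open>G\<close> gives a
  curve along which the derivative of \<open>P \<circ> F\<close> vanishes. Constancy of the rank makes \<open>P\<close> injective
  on the ranges of the nearby derivatives, so the derivative of \<open>F\<close> itself vanishes along the curve.
\<close>

lemma constant_rank_curve:
  fixes F :: "'y::real_normed_vector \<Rightarrow> 'e::euclidean_space"
  assumes "open N" "p \<in> N"
    and F: "\<And>q. q \<in> N \<Longrightarrow> (F has_derivative D q) (at q)"
    and contD: "\<And>x. continuous_on N (\<lambda>q. D q x)"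
    and rank: "\<And>q. q \<in> N \<Longrightarrow> dim (range (D q)) = dim (range (D p))"
    and u: "D p u = 0"
  obtains \<delta> \<gamma> where "\<delta> > 0" "continuous_on {-\<delta><..<\<delta>} \<gamma>" "\<gamma> 0 = p"
    "\<And>t. t \<in> {-\<delta><..<\<delta>} \<Longrightarrow> F (\<gamma> t) = F p" "(\<gamma> has_vector_derivative u) (at (0::real))"
proof -
  have linD: "linear (D q)" if "q \<in> N" for q
    using F[OF that] has_derivative_linear by blast
  obtain M where M: "linear M" "\<And>b. b \<in> range (D p) \<Longrightarrow> D p (M b) = b"
    using linear_exists_right_inverse_on[OF linD[OF \<open>p \<in> N\<close>] subspace_UNIV] by auto
  define P where "P = D p \<circ> M"
  have linP: "linear P"
    unfolding P_def by (intro linear_compose M(1) linD \<open>p \<in> N\<close>)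
  have rangeP: "P b \<in> range (D p)" for b
    by (simp add: P_def)
  have idP: "P b = b" if "b \<in> range (D p)" for b
    using M(2)[OF that] by (simp add: P_def)
  have PP: "P (P b) = P b" for b
    using idP rangeP by blast
  have blM: "bounded_linear M" and blP: "bounded_linear P"
    using M(1) linP by (auto simp: linear_conv_bounded_linear)
  define Y' where "Y' = (\<lambda>a. fst a *\<^sub>R u + M (snd a))"
  define Y where "Y = (\<lambda>a::real \<times> 'e. p + Y' a)"
  have blY': "bounded_linear Y'"
    unfolding Y'_def
    by (intro bounded_linear_add bounded_linear_scaleR_const bounded_linear_fst
        bounded_linear_compose[OF blM] bounded_linear_snd)
  have Y_der: "(Y has_derivative Y') (at a)" for a
    unfolding Y_def using has_derivative_add[OF has_derivative_const bounded_linear_imp_has_derivative[OF blY']]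
    by simp
  have contY: "continuous_on UNIV Y"
    by (intro continuous_at_imp_continuous_on ballI has_derivative_continuous[OF Y_der])
  define U where "U = Y -` N"
  have "open U"
    unfolding U_def by (rule open_vimage[OF \<open>open N\<close> contY])
  have Y0: "Y (0, 0) = p"
    using linear_0[OF M(1)] by (simp add: Y_def Y'_def)
  have U0: "(0, 0) \<in> U"
    using Y0 \<open>p \<in> N\<close> by (simp add: U_def)
  define H where "H = (\<lambda>a. (fst a, P (F (Y a)) + (snd a - P (snd a))))"
  define H' where "H' = (\<lambda>a b. (fst b :: real, P (D (Y a) (Y' b)) + (snd b - P (snd b))))"
  have FY_der: "((\<lambda>a. F (Y a)) has_derivative (\<lambda>b. D (Y a) (Y' b))) (at a)" if "a \<in> U" for a
    using that by (intro has_derivative_compose[OF Y_der F]) (simp add: U_def)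
  have H_der: "(H has_derivative H' a) (at a)" if "a \<in> U" for a
    unfolding H_def H'_def
    by (intro has_derivative_Pair has_derivative_add has_derivative_diff has_derivative_fst
        has_derivative_snd has_derivative_ident bounded_linear.has_derivative[OF blP] FY_der[OF that])
  have blH': "bounded_linear (H' a)" if "a \<in> U" for a
    using H_der[OF that] by (rule has_derivative_bounded_linear)
  have contH': "continuous_on U (\<lambda>a. Blinfun (H' a))"
  proof (rule continuous_on_blinfun_componentwise)
    fix i :: "real \<times> 'e"
    have "continuous_on U (\<lambda>a. D (Y a) (Y' i))"
      by (rule continuous_on_compose2[OF contD continuous_on_subset[OF contY]]) (auto simp: U_def)
    then have "continuous_on U (\<lambda>a. H' a i)"
      unfolding H'_def
      by (intro continuous_on_Pair continuous_on_add continuous_on_const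
          bounded_linear.continuous_on[OF blP])
    then show "continuous_on U (\<lambda>a. blinfun_apply (Blinfun (H' a)) i)"
      by (rule continuous_on_eq) (simp add: bounded_linear_Blinfun_apply blH')
  qed
  have "H' (0, 0) = (\<lambda>a. a)"
  proof
    fix a :: "real \<times> 'e"
    have "D p (Y' a) = P (snd a)"
      using linD[OF \<open>p \<in> N\<close>] u by (simp add: linear_add linear_scale P_def Y'_def)
    then show "H' (0, 0) a = a"
      by (simp add: H'_def Y0 PP)
  qed
  then have H'0: "id_blinfun o\<^sub>L Blinfun (H' (0, 0)) = id_blinfun"
    by (intro blinfun_eqI) (simp add: bounded_linear_Blinfun_apply bounded_linear_ident)
  have H_blinfun: "(H has_derivative blinfun_apply (Blinfun (H' a))) (at a)" if "a \<in> U" for a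
    using H_der[OF that] by (simp add: bounded_linear_Blinfun_apply[OF blH'[OF that]])
  obtain U' V G G' where G: "open U'" "U' \<subseteq> U" "(0, 0) \<in> U'" "open V" "H (0, 0) \<in> V"
      "homeomorphism U' V H G"
    and G_der: "\<And>y. y \<in> V \<Longrightarrow> (G has_derivative G' y) (at y)"
    and "\<And>y. y \<in> V \<Longrightarrow> G' y = inv (blinfun_apply (Blinfun (H' (G y))))"
    and G_bij: "\<And>y. y \<in> V \<Longrightarrow> bij (blinfun_apply (Blinfun (H' (G y))))"
    using inverse_function_theorem[OF \<open>open U\<close> H_blinfun contH' U0 H'0] by blast
  have GV: "G y \<in> U'" "H (G y) = y" if "y \<in> V" for y
    using G(6) that unfolding homeomorphism_def by auto
  have GU: "G y \<in> U" and GN: "Y (G y) \<in> N" if "y \<in> V" for y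
    using GV(1)[OF that] G(2) unfolding U_def by blast+
  have bij: "bij (H' (G y))" if "y \<in> V" for y
    using G_bij[OF that] by (simp add: bounded_linear_Blinfun_apply[OF blH'[OF GU[OF that]]])
  have kernel: "D (Y (G y)) x = 0" if y: "y \<in> V" and "P (D (Y (G y)) x) = 0" for y x
  proof -
    let ?T = "range (D (Y (G y)))"
    note N = GN[OF y]
    \<comment> \<open>The derivative of H is bijective near the origin. Restricted to vectors with no time
      component and with the other component in the range of D p, where the summand z - P z
      vanishes, it is the map below.\<close>
    have inj: "inj_on (\<lambda>\<zeta>. P (D (Y (G y)) (M \<zeta>))) (range (D p))"
    proof (rule inj_onI)
      fix a b assume ab: "a \<in> range (D p)" "b \<in> range (D p)"
        "P (D (Y (G y)) (M a)) = P (D (Y (G y)) (M b))"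
      then have "H' (G y) (0, a) = H' (G y) (0, b)"
        by (simp add: H'_def Y'_def idP)
      then show "a = b"
        using bij[OF y] by (auto dest: bij_is_inj injD)
    qed
    have lin: "linear (\<lambda>\<zeta>. P (D (Y (G y)) (M \<zeta>)))"
      using linear_compose[OF linear_compose[OF M(1) linD[OF N]] linP] by (simp add: o_def)
    have "dim ?T = dim (range (D p))"
      using rank[OF N] .
    also have "\<dots> = dim ((\<lambda>\<zeta>. P (D (Y (G y)) (M \<zeta>))) ` range (D p))"
      using dim_image_eq[OF lin] inj linD[OF \<open>p \<in> N\<close>]
      by (simp add: span_eq_iff[THEN iffD2] linear_subspace_image)
    also have "\<dots> \<le> dim (P ` ?T)"
      by (rule dim_subset) auto
    finally have "dim ?T \<le> dim (P ` ?T)" .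
    from linear_kernel_trivial_on_subspace[OF linear_subspace_image[OF linD[OF N] subspace_UNIV] linP this]
    show ?thesis
      using that(2) by blast
  qed
  define \<eta> where "\<eta> = (\<lambda>s::real. (s, P (F p)))"
  define \<gamma> where "\<gamma> = (\<lambda>s. Y (G (\<eta> s)))"
  have \<eta>_der: "(\<eta> has_derivative (\<lambda>s. (s, 0))) (at s)" for s
    unfolding \<eta>_def by (auto intro!: derivative_eq_intros)
  have H0: "H (0, 0) = \<eta> 0"
    using linear_0[OF linP] by (simp add: H_def \<eta>_def Y0)
  have G0: "G (\<eta> 0) = (0, 0)"
    using G(3,6) H0 unfolding homeomorphism_def by metis
  have "open (\<eta> -` V)"
    using \<open>open V\<close> unfolding \<eta>_def by (intro continuous_open_vimage) (auto intro!: continuous_intros)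
  moreover have "0 \<in> \<eta> -` V"
    using G(5) H0 by simp
  ultimately obtain \<delta> where \<delta>: "\<delta> > 0" "ball 0 \<delta> \<subseteq> \<eta> -` V"
    using open_contains_ball by blast
  then have \<eta>V: "\<eta> s \<in> V" if "s \<in> {-\<delta><..<\<delta>}" for s
    using that by (auto simp: subset_iff dist_real_def)
  \<comment> \<open>Differentiating H (G (\<eta> s)) = \<eta> s shows that the derivative of H maps the velocity of
    G \<circ> \<eta> to (1, 0).\<close>
  have curve: "(\<gamma> has_vector_derivative Y' v) (at s)" "H' (G (\<eta> s)) v = (1, 0)"
    if s: "s \<in> {-\<delta><..<\<delta>}" and v: "v = G' (\<eta> s) (1, 0)" for s v
  proof -
    have G\<eta>: "((\<lambda>s. G (\<eta> s)) has_derivative (\<lambda>s'. G' (\<eta> s) (s', 0))) (at s)"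
      by (rule has_derivative_compose[OF \<eta>_der G_der[OF \<eta>V[OF s]]])
    have "(\<gamma> has_derivative (\<lambda>s'. Y' (G' (\<eta> s) (s', 0)))) (at s)"
      unfolding \<gamma>_def by (rule has_derivative_compose[OF G\<eta> Y_der])
    moreover have "linear (\<lambda>s'. Y' (G' (\<eta> s) (s', 0)))"
      using calculation by (rule has_derivative_linear)
    then have "Y' (G' (\<eta> s) (s', 0)) = s' *\<^sub>R Y' v" for s'
      unfolding v using linear_scale[of "\<lambda>s'. Y' (G' (\<eta> s) (s', 0))" s' 1] by simp
    ultimately show "(\<gamma> has_vector_derivative Y' v) (at s)"
      by (simp add: has_vector_derivative_def)
    have "((\<lambda>s. H (G (\<eta> s))) has_derivative (\<lambda>s'. H' (G (\<eta> s)) (G' (\<eta> s) (s', 0)))) (at s)"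
      by (rule has_derivative_compose[OF G\<eta> H_der[OF GU[OF \<eta>V[OF s]]]])
    moreover have "((\<lambda>s. H (G (\<eta> s))) has_derivative (\<lambda>s. (s, 0))) (at s)"
      by (rule has_derivative_transform_within_open[OF \<eta>_der, of "{-\<delta><..<\<delta>}"])
        (use s \<eta>V GV(2) in auto)
    ultimately have "(\<lambda>s'. H' (G (\<eta> s)) (G' (\<eta> s) (s', 0))) = (\<lambda>s. (s, 0))"
      by (rule has_derivative_unique)
    then show "H' (G (\<eta> s)) v = (1, 0)"
      unfolding v by meson
  qed
  have const: "F (\<gamma> s) = F p" if "s \<in> {-\<delta><..<\<delta>}" for s
  proof -
    have "((\<lambda>s. F (\<gamma> s)) has_derivative (\<lambda>_. 0)) (at s)" if s: "s \<in> {-\<delta><..<\<delta>}" for s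
    proof -
      define v where v: "v = G' (\<eta> s) (1, 0)"
      let ?d = "D (\<gamma> s) (Y' v)"
      have "P ?d + (snd v - P (snd v)) = 0"
        using curve(2)[OF s v] by (simp add: H'_def \<gamma>_def)
      \<comment> \<open>The two summands lie in complementary subspaces, so both vanish.\<close>
      then have "P (P ?d + (snd v - P (snd v))) = 0"
        using linear_0[OF linP] by simp
      then have "P ?d = 0"
        by (simp add: linear_add[OF linP] linear_diff[OF linP] PP)
      then have d0: "?d = 0"
        using kernel[OF \<eta>V[OF s]] by (simp add: \<gamma>_def)
      have N: "\<gamma> s \<in> N"
        unfolding \<gamma>_def by (rule GN[OF \<eta>V[OF s]])
      have "(\<gamma> has_derivative (\<lambda>h. h *\<^sub>R Y' v)) (at s)"
        using curve(1)[OF s v] by (simp add: has_vector_derivative_def)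
      from has_derivative_compose[OF this F[OF N]] show ?thesis
        by (simp add: linear_scale[OF linD[OF N]] d0)
    qed
    then have "F (\<gamma> 0) = F (\<gamma> s)"
      by (rule has_derivative_zero_unique_connected[OF open_real_greaterThanLessThan
            connected_Ioo[of "-\<delta>" \<delta>]]) (use that \<delta>(1) in auto)
    then show ?thesis by (simp add: \<gamma>_def G0 Y0)
  qed
  show ?thesis
  proof
    show "\<delta> > 0" by (rule \<delta>(1))
    show "\<gamma> 0 = p" by (simp add: \<gamma>_def G0 Y0)
    show "continuous_on {-\<delta><..<\<delta>} \<gamma>"
      using curve(1)[OF _ refl] by (intro continuous_at_imp_continuous_on ballI)
        (metis has_vector_derivative_continuous)
    have s: "0 \<in> {-\<delta><..<\<delta>}" using \<delta>(1) by simp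
    show "(\<gamma> has_vector_derivative u) (at 0)"
      using curve[OF s refl] \<open>H' (0, 0) = (\<lambda>a. a)\<close> linear_0[OF M(1)] by (simp add: G0 Y'_def)
  qed (rule const)
qed

section \<open>Infinitesimal rigidity from continuous rigidity\<close>

text \<open>
  An infinitesimal flex is the velocity of a curve in the fibre by the constant rank theorem. Such
  a curve is a finite flex, which by assumption is trivial, and so is its velocity.
\<close>

lemma continuously_rigid_imp_infinitesimally_rigid:
  fixes p :: "'a::real_normed_vector ^ 'v::finite"
  assumes fd: "finite_dim TYPE('a)" and E: "simple_graph E"
    and const: "constant_framework E p" and rigid: "continuously_rigid E p"
  shows "infinitesimally_rigid E p"
proof -
  obtain N where N: "open N" "p \<in> N" "N \<subseteq> {q. well_positioned E q}"
    and rank: "\<And>q. q \<in> N \<Longrightarrow> rigidity_rank E q = rigidity_rank E p"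
    using const unfolding constant_framework_def by blast
  have "trivial_flex p u" if u: "rigidity_operator E p u = 0" for u
  proof -
    obtain \<delta> \<gamma> where \<gamma>: "\<delta> > 0" "continuous_on {-\<delta><..<\<delta>} \<gamma>" "\<gamma> 0 = p"
      and fibre: "\<And>t. t \<in> {-\<delta><..<\<delta>} \<Longrightarrow> rigidity_map E (\<gamma> t) = rigidity_map E p"
      and der: "(\<gamma> has_vector_derivative u) (at 0)"
      using constant_rank_curve[where F = "rigidity_map E" and D = "rigidity_operator E",
          OF N(1,2) has_derivative_rigidity_map[OF fd E N(1,3)]
            continuous_on_rigidity_operator[OF fd E N(3)] rank[unfolded rigidity_rank_def] u]
      by blast
    define \<alpha> where "\<alpha> v t = \<gamma> t $ v" for v t
    have "continuous_path p \<delta> \<alpha>"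
      using \<gamma> unfolding continuous_path_def \<alpha>_def by (auto intro!: continuous_intros)
    moreover have "norm (\<alpha> v t - \<alpha> w t) = norm (p $ v - p $ w)"
      if "{v, w} \<in> E" "t \<in> {-\<delta><..<\<delta>}" for v w t
      using rigidity_map_nth[OF that(1), of "\<gamma> t"] rigidity_map_nth[OF that(1), of p] fibre[OF that(2)]
      by (simp add: \<alpha>_def)
    ultimately have "finite_flex E p \<delta> \<alpha>"
      unfolding finite_flex_def by blast
    then have "trivial_finite_motion p \<delta> \<alpha>"
      using rigid unfolding continuously_rigid_def by blast
    moreover have "(\<alpha> v has_vector_derivative u $ v) (at 0)" for v
      unfolding \<alpha>_def by (rule bounded_linear.has_vector_derivative[OF bounded_linear_vec_nth der])
    ultimately show ?thesis
      unfolding trivial_flex_def by blast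
  qed
  then show ?thesis
    using const unfolding infinitesimally_rigid_def infinitesimal_flex_def constant_framework_def
    by blast
qed

section \<open>The action of isometries on placements\<close>

text \<open>
  Isometries act on placements. The action preserves the distance of placements and the rigidity
  map, and this lets statements near \<open>p\<close> be transported along the orbit of \<open>p\<close>.
\<close>

definition move :: "('a \<Rightarrow> 'a) \<Rightarrow> 'a ^ 'v \<Rightarrow> 'a ^ 'v::finite" where
  "move g x = (\<chi> v. g (x $ v))"

lemma orbit_eq_move: "orbit p = (\<lambda>g. move g p) ` isometries"
  unfolding orbit_def move_def by blast

lemma isometries_comp: "g \<in> isometries \<Longrightarrow> h \<in> isometries \<Longrightarrow> g \<circ> h \<in> isometries"
  by (auto simp: isometries_def intro: bij_comp)

lemma isometries_inv: "g \<in> isometries \<Longrightarrow> inv g \<in> isometries"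
  unfolding isometries_def by (auto simp: bij_imp_bij_inv) (metis bij_inv_eq_iff)

lemma move_inv:
  assumes "g \<in> isometries"
  shows "move (inv g) (move g x) = x" "move g (move (inv g) x) = x"
  using assms by (auto simp: isometries_def move_def bij_is_inj bij_is_surj surj_f_inv_f)

lemma dist_move: "g \<in> isometries \<Longrightarrow> dist (move g x) (move g y) = dist x y"
  by (simp add: dist_vec_def move_def isometries_def dist_norm)

lemma rigidity_map_move: "g \<in> isometries \<Longrightarrow> rigidity_map E (move g x) = rigidity_map E x"
  by (simp add: rigidity_map_def move_def isometries_def)

lemma move_in_orbit_iff:
  assumes "g \<in> isometries"
  shows "move g x \<in> orbit p \<longleftrightarrow> x \<in> orbit p"
proof -
  have step: "move h y \<in> orbit p" if "h \<in> isometries" "y \<in> orbit p" for h y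
  proof -
    obtain k where "k \<in> isometries" "y = move k p"
      using \<open>y \<in> orbit p\<close> unfolding orbit_eq_move by blast
    then have "move h y = move (h \<circ> k) p" "h \<circ> k \<in> isometries"
      using isometries_comp[OF \<open>h \<in> isometries\<close>] by (auto simp: move_def)
    then show ?thesis unfolding orbit_eq_move by blast
  qed
  show ?thesis
    using step[OF assms] step[OF isometries_inv[OF assms], of "move g x"] by (auto simp: move_inv[OF assms])
qed

lemma self_in_orbit: "p \<in> orbit p"
proof -
  have "id \<in> isometries" by (simp add: isometries_def)
  moreover have "move id p = p" by (simp add: move_def)
  ultimately show ?thesis unfolding orbit_eq_move by force
qed

lemma orbit_subset_fibre: "x \<in> orbit p \<Longrightarrow> rigidity_map E x = rigidity_map E p"
  unfolding orbit_eq_move using rigidity_map_move by blast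

section \<open>Orbits are closed\<close>

text \<open>
  If \<open>y\<close> had positive distance \<open>e\<close> from the image, then all iterates \<open>(g ^^ n) y\<close> would be at
  distance at least \<open>e\<close> from each other, which compactness forbids.
\<close>

lemma distance_preserving_compact_surj:
  fixes g :: "'b::metric_space \<Rightarrow> 'b"
  assumes "compact K" "g ` K \<subseteq> K"
    and iso: "\<And>x y. x \<in> K \<Longrightarrow> y \<in> K \<Longrightarrow> dist (g x) (g y) = dist x y"
  shows "g ` K = K"
proof (rule ccontr)
  assume "g ` K \<noteq> K"
  then obtain y where y: "y \<in> K" "y \<notin> g ` K" using assms(2) by blast
  have "continuous_on K g"
    unfolding continuous_on_iff using iso by metis
  then have "closed (g ` K)"
    using assms(1) compact_continuous_image compact_imp_closed by blast
  then obtain e where "e > 0" "ball y e \<subseteq> - g ` K"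
    using y(2) unfolding closed_def open_contains_ball by (meson ComplI)
  then have e: "e > 0" "\<And>z. z \<in> g ` K \<Longrightarrow> e \<le> dist y z"
    by (auto simp: subset_iff not_less[symmetric])
  have inK: "(g ^^ n) y \<in> K" for n
    using y(1) assms(2) by (induction n) (auto simp: image_subset_iff)
  have sep: "e \<le> dist ((g ^^ m) y) ((g ^^ n) y)" if "m < n" for m n
    using that
  proof (induction m arbitrary: n)
    case 0
    then obtain k where "n = Suc k" by (cases n) auto
    then show ?case using e(2) inK[of k] by auto
  next
    case (Suc m)
    then obtain k where "n = Suc k" "m < k" by (cases n) auto
    then show ?case using Suc.IH[of k] iso[OF inK inK] by simp
  qed
  obtain l r where r: "strict_mono (r::nat \<Rightarrow> nat)" "(\<lambda>n. (g ^^ r n) y) \<longlonglongrightarrow> l"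
    using assms(1)[unfolded compact_def, rule_format, of "\<lambda>n. (g ^^ n) y"] inK by (auto simp: o_def)
  then have "Cauchy (\<lambda>n. (g ^^ r n) y)"
    by (intro LIMSEQ_imp_Cauchy)
  then obtain N where "\<And>m n. m \<ge> N \<Longrightarrow> n \<ge> N \<Longrightarrow> dist ((g ^^ r m) y) ((g ^^ r n) y) < e"
    using e(1) unfolding Cauchy_def by blast
  from this[of N "Suc N"] sep[of "r N" "r (Suc N)"] strict_monoD[OF r(1), of N "Suc N"]
  show False by simp
qed

text \<open>
  A distance-preserving map is surjective, since after a translation it maps every closed ball
  around the origin into itself, hence onto itself. Being an isometry thus is a closed condition on maps.
\<close>

lemma isometries_iff:
  assumes "finite_dim TYPE('a::real_normed_vector)"
  shows "g \<in> isometries \<longleftrightarrow> (\<forall>x y::'a. dist (g x) (g y) = dist x y)"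
proof
  assume iso: "\<forall>x y::'a. dist (g x) (g y) = dist x y"
  have "y \<in> range g" for y
  proof -
    let ?h = "\<lambda>x. g x - g 0"
    let ?K = "cball 0 (norm (y - g 0))"
    have h: "dist (?h x) (?h x') = dist x x'" for x x'
      using iso by (simp add: dist_norm)
    have "norm (?h x) = norm x" for x
      using h[of x 0] by simp
    then have "?h ` ?K = ?K"
      using h by (intro distance_preserving_compact_surj finite_dim_compact[OF assms]) auto
    moreover have "y - g 0 \<in> ?K" by simp
    ultimately have "y - g 0 \<in> ?h ` ?K" by blast
    then show ?thesis by auto
  qed
  moreover have "inj g"
    using iso by (metis dist_eq_0_iff injI)
  ultimately show "g \<in> isometries"
    using iso by (auto simp: isometries_def bij_def dist_norm)
qed (auto simp: isometries_def dist_norm)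

text \<open>
  Isometries that move one vertex of \<open>p\<close> by at most \<open>R\<close> send each point \<open>x\<close> of the space into a ball
  that depends on \<open>x\<close> alone, so by Tychonoff's theorem they form a compact set of maps. Evaluation at the vertices
  of \<open>p\<close> is continuous on it.
\<close>

lemma compact_orbit_Int_cball:
  fixes p :: "'a::real_normed_vector ^ 'v::finite"
  assumes "finite_dim TYPE('a)"
  shows "compact (orbit p \<inter> cball p R)"
proof -
  \<comment> \<open>Any vertex serves.\<close>
  define w :: 'v where "w = undefined"
  define I where "I = {g::'a \<Rightarrow> 'a. \<forall>x. g x \<in> cball (p $ w) (dist x (p $ w) + R)} \<inter>
      {g. \<forall>x y. dist (g x) (g y) = dist x y}"
  have "closed {g::'a \<Rightarrow> 'a. \<forall>x y. dist (g x) (g y) = dist x y}"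
    by (intro closed_Collect_all closed_Collect_eq continuous_on_dist continuous_on_const
        continuous_on_product_coordinates)
  then have "compact I"
    unfolding I_def by (intro compact_Int_closed compact_pointwise finite_dim_compact assms) auto
  then have "compact ((\<lambda>g. \<chi> v. g (p $ v)) ` I)"
    by (intro compact_continuous_image continuous_on_vec_lambda
        continuous_on_subset[OF continuous_on_product_coordinates]) auto
  then have "compact ((\<lambda>g. \<chi> v. g (p $ v)) ` I \<inter> cball p R)"
    by (intro compact_Int_closed) auto
  moreover have "orbit p \<inter> cball p R = (\<lambda>g. \<chi> v. g (p $ v)) ` I \<inter> cball p R"
  proof (intro equalityI subsetI IntI; elim IntE)
    fix z assume z: "z \<in> orbit p" "z \<in> cball p R"
    then obtain g where g: "g \<in> isometries" "z = (\<chi> v. g (p $ v))"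
      unfolding orbit_def by blast
    have "dist (p $ w) (g (p $ w)) \<le> R"
      using z(2) dist_vec_nth_le[of p w z] by (simp add: g(2))
    moreover have "dist (g (p $ w)) (g x) = dist x (p $ w)" for x
      using g(1) isometries_iff[OF assms] by (metis dist_commute)
    ultimately have "dist (p $ w) (g x) \<le> dist x (p $ w) + R" for x
      using dist_triangle[of "p $ w" "g x" "g (p $ w)"] by (smt (verit))
    then have "g \<in> I" using g(1) unfolding I_def isometries_iff[OF assms] by simp
    then show "z \<in> (\<lambda>g. \<chi> v. g (p $ v)) ` I" using g(2) by blast
  next
    fix z assume "z \<in> (\<lambda>g. \<chi> v. g (p $ v)) ` I" "z \<in> cball p R"
    then show "z \<in> orbit p"
      unfolding orbit_def I_def using isometries_iff[OF assms] by blast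
  qed auto
  ultimately show ?thesis by simp
qed

lemma closed_if_compact_Int_cball:
  fixes S :: "'b::metric_space set"
  assumes "\<And>R. compact (S \<inter> cball p R)"
  shows "closed S"
  unfolding closed_sequential_limits
proof (intro allI impI, elim conjE)
  fix X l assume X: "\<forall>n. X n \<in> S" "X \<longlonglongrightarrow> l"
  then have "bounded (range X)"
    using convergent_imp_bounded by blast
  then obtain R where R: "\<And>n. dist p (X n) \<le> R"
    using bounded_any_center[of "range X" p] by auto
  have "closed (S \<inter> cball p R)"
    using assms compact_imp_closed by blast
  moreover have "\<forall>n. X n \<in> S \<inter> cball p R"
    using X(1) R by simp
  ultimately have "l \<in> S \<inter> cball p R"
    using X(2) closed_sequentially by blast
  then show "l \<in> S" by simp
qed

lemma closed_orbit:
  fixes p :: "'a::real_normed_vector ^ 'v::finite"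
  assumes "finite_dim TYPE('a)"
  shows "closed (orbit p)"
  using compact_orbit_Int_cball[OF assms] by (rule closed_if_compact_Int_cball)

lemma orbit_nearest_point:
  fixes p :: "'a::real_normed_vector ^ 'v::finite"
  assumes "finite_dim TYPE('a)"
  obtains y where "y \<in> orbit p" "\<And>z. z \<in> orbit p \<Longrightarrow> dist x y \<le> dist x z"
proof -
  \<comment> \<open>Points of the orbit outside of this ball are farther from x than p is.\<close>
  let ?K = "orbit p \<inter> cball p (2 * dist x p)"
  have pK: "p \<in> ?K" using self_in_orbit by simp
  then have ne: "?K \<noteq> {}" by blast
  have "continuous_on ?K (dist x)"
    by (intro continuous_intros)
  then obtain y where y: "y \<in> ?K" "\<And>z. z \<in> ?K \<Longrightarrow> dist x y \<le> dist x z"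
    using continuous_attains_inf[OF compact_orbit_Int_cball[OF assms] ne] by meson
  have "dist x y \<le> dist x z" if "z \<in> orbit p" for z
  proof (cases "z \<in> ?K")
    case False
    then have "dist p z > 2 * dist x p" using that by simp
    moreover have "dist p z \<le> dist x p + dist x z" by (metis dist_commute dist_triangle)
    ultimately show ?thesis using y(2)[OF pK] by linarith
  qed (rule y(2))
  then show ?thesis using that y(1) by blast
qed

section \<open>Continuous rigidity from local rigidity\<close>

text \<open>
  The times at which a finite flex lies in the orbit form a closed set, because the orbit is
  closed. They form an open set as well: local rigidity at \<open>p\<close> is carried by an isometry to every
  other point of the orbit. The interval of times is connected.
\<close>

lemma locally_rigid_imp_continuously_rigid:
  fixes p :: "'a::real_normed_vector ^ 'v::finite"
  assumes fd: "finite_dim TYPE('a)" and E: "simple_graph E" and "locally_rigid E p"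
  shows "continuously_rigid E p"
  unfolding continuously_rigid_def
proof (intro allI impI)
  fix \<delta> \<alpha> assume flex: "finite_flex E p \<delta> \<alpha>"
  obtain U where U: "open U" "p \<in> U"
    "\<And>x. x \<in> U \<Longrightarrow> rigidity_map E x = rigidity_map E p \<Longrightarrow> x \<in> orbit p"
    using assms(3) unfolding locally_rigid_def by blast
  let ?I = "{-\<delta><..<\<delta>}"
  define A where "A t = (\<chi> v. \<alpha> v t)" for t
  have path: "continuous_path p \<delta> \<alpha>"
    using flex by (simp add: finite_flex_def)
  then have contA: "continuous_on ?I A" and A0: "A 0 = p" and \<delta>: "\<delta> > 0"
    unfolding A_def continuous_path_def by (auto intro!: continuous_on_vec_lambda simp: vec_eq_iff)
  have fibre: "rigidity_map E (A t) = rigidity_map E p" if t: "t \<in> ?I" for t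
  proof -
    have "rigidity_map E (A t) $ e = rigidity_map E p $ e" for e
      using E
    proof (induction e rule: edge_cases)
      case non_edge
      then show ?case by (simp add: rigidity_map_def on_edges_outside)
    next
      case (edge v w)
      then show ?case using flex t by (simp add: finite_flex_def rigidity_map_nth A_def)
    qed
    then show ?thesis by (simp add: vec_eq_iff)
  qed
  let ?S = "?I \<inter> A -` orbit p"
  have "closedin (top_of_set ?I) ?S"
    by (intro continuous_closedin_preimage contA closed_orbit fd)
  moreover have "openin (top_of_set ?I) ?S"
    unfolding openin_subopen[of _ ?S]
  proof
    fix t assume t: "t \<in> ?S"
    then obtain g where g: "g \<in> isometries" "A t = move g p"
      unfolding orbit_eq_move by blast
    have "continuous_on UNIV (move (inv g) :: 'a ^ 'v \<Rightarrow> 'a ^ 'v)"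
      unfolding continuous_on_iff using dist_move[OF isometries_inv[OF g(1)]] by metis
    then have "open (move (inv g) -` U)"
      using U(1) by (intro open_vimage)
    then have "openin (top_of_set ?I) (?I \<inter> A -` (move (inv g) -` U))"
      by (intro continuous_openin_preimage_gen contA)
    moreover have "t \<in> ?I \<inter> A -` (move (inv g) -` U)"
      using t g U(2) by (simp add: move_inv)
    moreover have "?I \<inter> A -` (move (inv g) -` U) \<subseteq> ?S"
    proof
      fix s assume s: "s \<in> ?I \<inter> A -` (move (inv g) -` U)"
      then have "move (inv g) (A s) \<in> orbit p"
        using fibre by (intro U(3)) (auto simp: rigidity_map_move[OF isometries_inv[OF g(1)]])
      then show "s \<in> ?S"
        using s move_in_orbit_iff[OF isometries_inv[OF g(1)]] by blast
    qed
    ultimately show "\<exists>T. openin (top_of_set ?I) T \<and> t \<in> T \<and> T \<subseteq> ?S" by blast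
  qed
  moreover have "0 \<in> ?S"
    using \<delta> A0 self_in_orbit by auto
  ultimately have "?S = ?I"
    using connected_Ioo[of "-\<delta>" \<delta>] unfolding connected_clopen by blast
  then show "trivial_finite_motion p \<delta> \<alpha>"
    using path unfolding trivial_finite_motion_def A_def by blast
qed

section \<open>Local rigidity from infinitesimal rigidity\<close>

text \<open>
  Failure of local rigidity yields points of the fibre near \<open>p\<close> but not in the orbit. An isometry
  that carries the nearest point of the orbit back to \<open>p\<close> turns such a point into one for which
  \<open>p\<close> itself is the nearest.
\<close>

lemma fibre_point_nearest_orbit:
  fixes p :: "'a::real_normed_vector ^ 'v::finite"
  assumes fd: "finite_dim TYPE('a)" and "\<not> locally_rigid E p" and "\<epsilon> > 0"
  obtains x where "rigidity_map E x = rigidity_map E p" "x \<noteq> p" "dist x p < \<epsilon>"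
    "\<And>z. z \<in> orbit p \<Longrightarrow> dist x p \<le> dist x z"
proof -
  have "rigidity_map E -` {rigidity_map E p} \<inter> ball p \<epsilon> \<noteq> orbit p \<inter> ball p \<epsilon>"
    using assms(2,3) unfolding locally_rigid_def by (meson centre_in_ball open_ball)
  then obtain y where y: "rigidity_map E y = rigidity_map E p" "y \<notin> orbit p" "dist y p < \<epsilon>"
    using orbit_subset_fibre by (fastforce simp: dist_commute)
  obtain z where z: "z \<in> orbit p" "\<And>z'. z' \<in> orbit p \<Longrightarrow> dist y z \<le> dist y z'"
    using orbit_nearest_point[OF fd, of p y] by blast
  obtain g where g: "g \<in> isometries" "z = move g p"
    using z(1) unfolding orbit_eq_move by blast
  define x where "x = move (inv g) y"
  have y_eq: "y = move g x"
    unfolding x_def by (simp add: move_inv[OF g(1)])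
  have dist: "dist y (move g z') = dist x z'" for z'
    unfolding y_eq by (rule dist_move[OF g(1)])
  have nearest: "dist x p \<le> dist x z'" if "z' \<in> orbit p" for z'
    using z(2)[OF move_in_orbit_iff[OF g(1), THEN iffD2, OF that]] unfolding g(2) dist .
  have "rigidity_map E x = rigidity_map E p"
    using y(1) rigidity_map_move[OF g(1), of E x] by (simp add: y_eq)
  moreover have "x \<noteq> p"
    using y(2) move_in_orbit_iff[OF g(1)] self_in_orbit by (metis y_eq)
  moreover have "dist x p < \<epsilon>"
    using z(2)[OF self_in_orbit] y(3) by (simp add: g(2) dist)
  ultimately show ?thesis using that nearest by blast
qed

text \<open>
  Suppose that points \<open>X n\<close> of the fibre tend to \<open>p\<close> while \<open>p\<close> is the point of the orbit nearest to
  each of them. A limit \<open>u\<close> of their directions from \<open>p\<close> is an infinitesimal flex, hence by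
  rigidity the velocity of some motion \<open>A\<close> within the orbit. After passing to a subsequence, and with \<open>t n\<close> the distance of \<open>X n\<close> from \<open>p\<close>, both
  \<open>X n\<close> and \<open>A (t n)\<close> equal \<open>p + t n *\<^sub>R u\<close> up to an error that is small compared to \<open>t n\<close>. So
  \<open>A (t n)\<close> is an orbit point much closer to \<open>X n\<close> than \<open>p\<close> is.
\<close>

lemma infinitesimally_rigid_imp_locally_rigid:
  fixes p :: "'a::real_normed_vector ^ 'v::finite"
  assumes fd: "finite_dim TYPE('a)" and rigid: "infinitesimally_rigid E p"
    and der: "(rigidity_map E has_derivative rigidity_operator E p) (at p)"
  shows "locally_rigid E p"
proof (rule ccontr)
  assume "\<not> locally_rigid E p"
  then have "\<exists>x. rigidity_map E x = rigidity_map E p \<and> x \<noteq> p \<and> dist x p < inverse (real (Suc n)) \<and>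
      (\<forall>z\<in>orbit p. dist x p \<le> dist x z)" for n
    using fibre_point_nearest_orbit[OF fd, of E p "inverse (real (Suc n))"]
    by (metis inverse_positive_iff_positive of_nat_0_less_iff zero_less_Suc)
  then obtain X where X: "\<And>n. rigidity_map E (X n) = rigidity_map E p" "\<And>n. X n \<noteq> p"
    "\<And>n. dist (X n) p < inverse (real (Suc n))"
    "\<And>n z. z \<in> orbit p \<Longrightarrow> dist (X n) p \<le> dist (X n) z"
    by metis
  define d where "d n = (X n - p) /\<^sub>R norm (X n - p)" for n
  have "compact {x :: 'a ^ 'v. norm x = 1}"
    by (intro finite_dim_compact finite_dim_vec fd closed_Collect_eq continuous_intros)
      (auto simp: bounded_iff)
  moreover have "\<forall>n. d n \<in> {x. norm x = 1}"
    using X(2) by (simp add: d_def)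
  ultimately obtain u r where r: "strict_mono (r::nat \<Rightarrow> nat)" "(\<lambda>n. d (r n)) \<longlonglongrightarrow> u"
    unfolding compact_def o_def by meson
  have "(\<lambda>n. dist (X n) p) \<longlonglongrightarrow> 0"
    by (rule tendsto_sandwich[OF _ _ tendsto_const LIMSEQ_inverse_real_of_nat])
      (use X(3) in \<open>auto intro!: always_eventually less_imp_le\<close>)
  then have Xr: "(\<lambda>n. X (r n)) \<longlonglongrightarrow> p"
    using LIMSEQ_subseq_LIMSEQ[OF _ r(1)] by (fastforce simp: o_def tendsto_dist_iff[of _ p])
  define t where "t n = norm (X (r n) - p)" for n
  have t: "t \<longlonglongrightarrow> 0" "\<And>n. t n > 0"
    using Xr X(2) unfolding t_def by (auto intro: tendsto_norm_zero LIM_zero)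
  have td: "X (r n) - p = t n *\<^sub>R d (r n)" for n
    using t(2)[of n] by (simp add: t_def d_def)
  have "rigidity_operator E p u = 0"
  proof -
    have "((\<lambda>y. (1 / norm (y - p)) *\<^sub>R (rigidity_map E y -
        (rigidity_map E p + rigidity_operator E p (y - p)))) \<longlongrightarrow> 0) (at p)"
      using der by (simp add: has_derivative_at2)
    moreover have "filterlim (\<lambda>n. X (r n)) (at p) sequentially"
      using Xr X(2) by (simp add: filterlim_at)
    ultimately have "(\<lambda>n. (1 / norm (X (r n) - p)) *\<^sub>R (rigidity_map E (X (r n)) -
        (rigidity_map E p + rigidity_operator E p (X (r n) - p)))) \<longlonglongrightarrow> 0"
      by (rule filterlim_compose)
    moreover have "rigidity_operator E p (X (r n) - p) = t n *\<^sub>R rigidity_operator E p (d (r n))" for n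
      unfolding td by (rule linear_scale[OF has_derivative_linear[OF der]])
    then have "(1 / norm (X (r n) - p)) *\<^sub>R (rigidity_map E (X (r n)) -
        (rigidity_map E p + rigidity_operator E p (X (r n) - p))) = - rigidity_operator E p (d (r n))" for n
      using t(2)[of n] by (simp add: X(1) flip: t_def)
    ultimately have "(\<lambda>n. - rigidity_operator E p (d (r n))) \<longlonglongrightarrow> 0"
      by simp
    then have "(\<lambda>n. rigidity_operator E p (d (r n))) \<longlonglongrightarrow> 0"
      using tendsto_minus_cancel[of _ 0] by fastforce
    moreover have "(\<lambda>n. rigidity_operator E p (d (r n))) \<longlonglongrightarrow> rigidity_operator E p u"
      by (rule bounded_linear.tendsto[OF has_derivative_bounded_linear[OF der] r(2)])
    ultimately show ?thesis by (metis LIMSEQ_unique)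
  qed
  then have "trivial_flex p u"
    using rigid unfolding infinitesimally_rigid_def infinitesimal_flex_def by blast
  then obtain \<delta> \<alpha> where \<alpha>: "trivial_finite_motion p \<delta> \<alpha>"
      "\<And>v. (\<alpha> v has_vector_derivative u $ v) (at 0)"
    unfolding trivial_flex_def by blast
  then have \<delta>: "\<delta> > 0" "\<And>v. \<alpha> v 0 = p $ v" "\<And>s. s \<in> {-\<delta><..<\<delta>} \<Longrightarrow> (\<chi> v. \<alpha> v s) \<in> orbit p"
    by (auto simp: trivial_finite_motion_def continuous_path_def)
  define A where "A s = (\<chi> v. \<alpha> v s)" for s
  have t_at: "filterlim t (at 0) sequentially"
    using t by (simp add: filterlim_at less_imp_neq[THEN not_sym])
  have "(\<lambda>n. (1 / norm (t n - 0)) *\<^sub>R (\<alpha> v (t n) - (\<alpha> v 0 + (t n - 0) *\<^sub>R u $ v))) \<longlonglongrightarrow> 0" for v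
    using filterlim_compose[OF conjunct2[OF \<alpha>(2)[of v, unfolded has_vector_derivative_def
          has_derivative_at2]] t_at] .
  then have "(\<lambda>n. ((1 / t n) *\<^sub>R (A (t n) - (p + t n *\<^sub>R u))) $ v) \<longlonglongrightarrow> 0 $ v" for v
    using t(2) by (simp add: A_def \<delta>(2) abs_of_pos)
  then have "(\<lambda>n. (1 / t n) *\<^sub>R (A (t n) - (p + t n *\<^sub>R u))) \<longlonglongrightarrow> 0"
    by (rule vec_tendstoI)
  moreover have "(\<lambda>n. d (r n) - u) \<longlonglongrightarrow> 0"
    using r(2) by (rule LIM_zero)
  ultimately have "(\<lambda>n. (1 / t n) *\<^sub>R (A (t n) - (p + t n *\<^sub>R u)) - (d (r n) - u)) \<longlonglongrightarrow> 0 - 0"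
    by (rule tendsto_diff)
  moreover have "(1 / t n) *\<^sub>R (A (t n) - (p + t n *\<^sub>R u)) - (d (r n) - u) = (1 / t n) *\<^sub>R (A (t n) - X (r n))" for n
  proof -
    have eq: "A (t n) - X (r n) = (A (t n) - (p + t n *\<^sub>R u)) - t n *\<^sub>R (d (r n) - u)"
      using td[of n] by (simp add: algebra_simps)
    show ?thesis
      unfolding eq scaleR_diff_right[of _ _ "t n *\<^sub>R (d (r n) - u)"] using t(2)[of n] by simp
  qed
  ultimately have "(\<lambda>n. (1 / t n) *\<^sub>R (A (t n) - X (r n))) \<longlonglongrightarrow> 0"
    by simp
  then have "\<forall>\<^sub>F n in sequentially. norm ((1 / t n) *\<^sub>R (A (t n) - X (r n))) < 1"
    by (intro order_tendstoD(2)[OF tendsto_norm_zero]) simp_all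
  moreover have "\<forall>\<^sub>F n in sequentially. t n < \<delta>"
    using order_tendstoD(2)[OF t(1) \<delta>(1)] .
  ultimately have "\<forall>\<^sub>F n in sequentially. False"
  proof eventually_elim
    case (elim n)
    have "A (t n) \<in> orbit p"
      unfolding A_def using elim(2) t(2)[of n] by (intro \<delta>(3)) auto
    then have "t n \<le> norm (A (t n) - X (r n))"
      using X(4)[of "A (t n)" "r n"] by (simp add: t_def dist_norm norm_minus_commute)
    then show False
      using elim(1) t(2)[of n] by simp
  qed
  then show False by simp
qed

section \<open>Equivalence of the three notions of rigidity\<close>

theorem theorem1p1:
  fixes E :: "'v::finite set set"
    and p :: "'a::real_normed_vector ^ 'v"
  assumes "\<exists>B::'a set. finite B \<and> span B = UNIV"
    and "simple_graph E"
    and "constant_framework E p"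
  shows "(infinitesimally_rigid E p \<longleftrightarrow> locally_rigid E p) \<and>
         (locally_rigid E p \<longleftrightarrow> continuously_rigid E p)"
proof -
  have fd: "finite_dim TYPE('a)"
    using assms(1) unfolding finite_dim_def .
  obtain N where "open N" "p \<in> N" "N \<subseteq> {q. well_positioned E q}"
    using assms(3) unfolding constant_framework_def by blast
  then have "(rigidity_map E has_derivative rigidity_operator E p) (at p)"
    using has_derivative_rigidity_map[OF fd assms(2)] by blast
  then show ?thesis
    using infinitesimally_rigid_imp_locally_rigid[OF fd]
      locally_rigid_imp_continuously_rigid[OF fd assms(2)]
      continuously_rigid_imp_infinitesimally_rigid[OF fd assms(2,3)] by blast
qed

end
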